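(* Let $M\subseteq N$ and $r\in\mathbb{R}^{\mathcal{P}(M)}$. (i) Then $r\in\mathcal{K}(M)$ if and only if $T_{M\nearrow N}(r)\in\mathcal{K}(N)$, and the independency model induced by $T_{M\nearrow N}(r)$ is determined as follows: for any $\langle a,b|C\rangle\in\mathcal{E}(N)$, $$a\perp b\mid C\ [T_{M\nearrow N}(r)]\iff \bigl\{\,a\notin M\ \text{ or }\ b\notin M\ \text{ or }\ a\perp b\mid C\cap M\ [r]\,\bigr\}.$$ In particular, $T_{M\nearrow N}$ maps $\mathcal{K}(M)$ into $\mathcal{K}(N)$. (ii) The lifting transformation commutes with the basic standardizations: for $r\in\mathcal{K}(M)$, $$(T_{M\nearrow N}(r))_\ell=T_{M\nearrow N}(r_\ell),\quad (T_{M\nearrow N}(r))_u=T_{M\nearrow N}(r_u),\quad (T_{M\nearrow N}(r))_o=T_{M\nearrow N}(r_o).$$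
   Context: $N$ is a finite set with $|N|\ge 2$ and $\mathcal{P}(N)$ is its power set; a singleton $\{a\}$ is written $a$. $\mathbb{R}^{\mathcal{P}(N)}$ is the space of functions $m:\mathcal{P}(N)\to\mathbb{R}$. A function $m$ is supermodular if $m(A)+m(B)\le m(A\cup B)+m(A\cap B)$ for all $A,B\subseteq N$, and modular if equality always holds; $\mathcal{K}(N)$ and $\mathcal{L}(N)$ denote the classes of supermodular and modular functions. The same definitions are used for other finite sets in place of $N$. $\mathcal{E}(N)$ is the set of triplets $\langle a,b|C\rangle$ with $a,b\in N$ distinct and $C\subseteq N\setminus\{a,b\}$. For $m\in\mathbb{R}^{\mathcal{P}(N)}$, $a\perp b\mid C\ [m]$ means $m(a\cup b\cup C)+m(C)-m(a\cup C)-m(b\cup C)=0$. The independency model induced by $m\in\mathcal{K}(N)$ is the set of $\langle a,b|C\rangle\in\mathcal{E}(N)$ with $a\perp b\mid C\ [m]$. The lifting transformation $T_{M\nearrow N}:\mathbb{R}^{\mathcal{P}(M)}\to\mathbb{R}^{\mathcal{P}(N)}$ is $[T_{M\nearrow N}(r)](S)=r(S\cap M)$ for $S\subseteq N$. Standardizations: each of the following linear subspaces is complementary to $\mathcal{L}(N)$ in $\mathbb{R}^{\mathcal{P}(N)}$: $\mathcal{S}_\ell(N)=\{m: m(\emptyset)=0,\ m(i)=0\ \forall i\in N\}$; $\mathcal{S}_u(N)=\{m: m(N)=0,\ m(N\setminus i)=0\ \forall i\in N\}$; $\mathcal{S}_o(N)=\{m:\sum_{S\subseteq N}m(S)=0,\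 \sum_{S\subseteq N,\,i\in S}m(S)=0\ \forall i\in N\}$. For $m\in\mathbb{R}^{\mathcal{P}(N)}$, $m_\ell$, $m_u$, $m_o$ denote the unique elements of $\mathcal{S}_\ell(N)$, $\mathcal{S}_u(N)$, $\mathcal{S}_o(N)$, respectively, differing from $m$ by an element of $\mathcal{L}(N)$. *)

theory Defs
  imports Complex_Main "HOL-Library.FuncSet"
begin

text \<open>Elements of the space of real functions on the power set of \<open>N\<close> are represented by functions
  that are \<^const>\<open>undefined\<close> outside \<^term>\<open>Pow N\<close>, so that equality of such functions is
  equality on all subsets of \<open>N\<close>.\<close>

definition set_funs :: "'a set \<Rightarrow> ('a set \<Rightarrow> real) set" where
  "set_funs N = Pow N \<rightarrow>\<^sub>E UNIV"

definition supermodular_funs :: "'a set \<Rightarrow> ('a set \<Rightarrow> real) set" where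
  "supermodular_funs N =
     {m \<in> set_funs N. \<forall>A B. A \<subseteq> N \<longrightarrow> B \<subseteq> N \<longrightarrow> m A + m B \<le> m (A \<union> B) + m (A \<inter> B)}"

definition modular_funs :: "'a set \<Rightarrow> ('a set \<Rightarrow> real) set" where
  "modular_funs N =
     {m \<in> set_funs N. \<forall>A B. A \<subseteq> N \<longrightarrow> B \<subseteq> N \<longrightarrow> m A + m B = m (A \<union> B) + m (A \<inter> B)}"

definition triplets :: "'a set \<Rightarrow> ('a \<times> 'a \<times> 'a set) set" where
  "triplets N = {(a, b, C). a \<in> N \<and> b \<in> N \<and> a \<noteq> b \<and> C \<subseteq> N - {a, b}}"

definition indep :: "('a set \<Rightarrow> real) \<Rightarrow> 'a \<Rightarrow> 'a \<Rightarrow> 'a set \<Rightarrow> bool" where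
  "indep m a b C \<longleftrightarrow>
     m ({a} \<union> {b} \<union> C) + m C - m ({a} \<union> C) - m ({b} \<union> C) = 0"

definition indep_model :: "'a set \<Rightarrow> ('a set \<Rightarrow> real) \<Rightarrow> ('a \<times> 'a \<times> 'a set) set" where
  "indep_model N m = {(a, b, C). (a, b, C) \<in> triplets N \<and> indep m a b C}"

definition lift_fun :: "'a set \<Rightarrow> 'a set \<Rightarrow> ('a set \<Rightarrow> real) \<Rightarrow> ('a set \<Rightarrow> real)" where
  "lift_fun M N r = (\<lambda>S\<in>Pow N. r (S \<inter> M))"

definition std_space_l :: "'a set \<Rightarrow> ('a set \<Rightarrow> real) set" where
  "std_space_l N = {m \<in> set_funs N. m {} = 0 \<and> (\<forall>i\<in>N. m {i} = 0)}"

definition std_space_u :: "'a set \<Rightarrow> ('a set \<Rightarrow> real) set" where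
  "std_space_u N = {m \<in> set_funs N. m N = 0 \<and> (\<forall>i\<in>N. m (N - {i}) = 0)}"

definition std_space_o :: "'a set \<Rightarrow> ('a set \<Rightarrow> real) set" where
  "std_space_o N =
     {m \<in> set_funs N. (\<Sum>S\<in>Pow N. m S) = 0 \<and> (\<forall>i\<in>N. (\<Sum>S\<in>{S \<in> Pow N. i \<in> S}. m S) = 0)}"

text \<open>For finite \<open>N\<close> (including the empty set and singletons) each of the three subspaces is
  complementary to \<^term>\<open>modular_funs N\<close>, so the element described below exists and is unique.\<close>

definition standardization ::
    "('a set \<Rightarrow> ('a set \<Rightarrow> real) set) \<Rightarrow> 'a set \<Rightarrow> ('a set \<Rightarrow> real) \<Rightarrow> ('a set \<Rightarrow> real)" where
  "standardization X N m =
     (THE s. s \<in> X N \<and> (\<lambda>S\<in>Pow N. m S - s S) \<in> modular_funs N)"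

abbreviation std_l :: "'a set \<Rightarrow> ('a set \<Rightarrow> real) \<Rightarrow> ('a set \<Rightarrow> real)" where
  "std_l \<equiv> standardization std_space_l"

abbreviation std_u :: "'a set \<Rightarrow> ('a set \<Rightarrow> real) \<Rightarrow> ('a set \<Rightarrow> real)" where
  "std_u \<equiv> standardization std_space_u"

abbreviation std_o :: "'a set \<Rightarrow> ('a set \<Rightarrow> real) \<Rightarrow> ('a set \<Rightarrow> real)" where
  "std_o \<equiv> standardization std_space_o"

end

theory Submission
  imports Defs
begin

text \<open>A modular function on \<open>Pow N\<close> has the form \<open>S \<mapsto> c + (\<Sum>i\<in>S. a i)\<close>. Each standardizing
  subspace is the common kernel of one functional recovering the constant \<open>c\<close> (once \<open>a\<close> is known) and,
  for every \<open>i\<close>, one functional that recovers a nonzero multiple of the slope \<open>a i\<close> and kills constants;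
  hence the subspace is complementary to the modular functions. Lifting preserves modularity and maps each
  standardizing subspace over \<open>M\<close> into the one over \<open>N\<close>, so by uniqueness it commutes with
  standardization.\<close>

section \<open>Lifting, supermodularity and conditional independence\<close>

lemma lift_fun_in_set_funs: "lift_fun M N r \<in> set_funs N"
  by (auto simp: lift_fun_def set_funs_def)

lemma lift_fun_apply: "S \<subseteq> N \<Longrightarrow> lift_fun M N r S = r (S \<inter> M)"
  by (simp add: lift_fun_def)

lemma lift_fun_supermodular:
  assumes "r \<in> supermodular_funs M"
  shows "lift_fun M N r \<in> supermodular_funs N"
proof -
  have "r (A \<inter> M) + r (B \<inter> M) \<le> r ((A \<union> B) \<inter> M) + r (A \<inter> B \<inter> M)" for A B
  proof -
    have "r (A \<inter> M) + r (B \<inter> M) \<le> r ((A \<inter> M) \<union> (B \<inter> M)) + r ((A \<inter> M) \<inter> (B \<inter> M))"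
      using assms by (auto simp: supermodular_funs_def)
    moreover have "(A \<inter> M) \<union> (B \<inter> M) = (A \<union> B) \<inter> M" "(A \<inter> M) \<inter> (B \<inter> M) = A \<inter> B \<inter> M"
      by auto
    ultimately show ?thesis by simp
  qed
  then show ?thesis
    by (auto simp: supermodular_funs_def lift_fun_in_set_funs lift_fun_apply le_infI1)
qed

lemma modular_funsD:
  "m \<in> modular_funs N \<Longrightarrow> A \<subseteq> N \<Longrightarrow> B \<subseteq> N \<Longrightarrow> m A + m B = m (A \<union> B) + m (A \<inter> B)"
  unfolding modular_funs_def by blast

lemma modular_funsI:
  "m \<in> set_funs N \<Longrightarrow> (\<And>A B. A \<subseteq> N \<Longrightarrow> B \<subseteq> N \<Longrightarrow> m A + m B = m (A \<union> B) + m (A \<inter> B))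
    \<Longrightarrow> m \<in> modular_funs N"
  unfolding modular_funs_def by blast

lemma lift_fun_modular:
  assumes "r \<in> modular_funs M"
  shows "lift_fun M N r \<in> modular_funs N"
proof -
  have "r (A \<inter> M) + r (B \<inter> M) = r ((A \<union> B) \<inter> M) + r (A \<inter> B \<inter> M)" for A B
  proof -
    have "r (A \<inter> M) + r (B \<inter> M) = r ((A \<inter> M) \<union> (B \<inter> M)) + r ((A \<inter> M) \<inter> (B \<inter> M))"
      by (rule modular_funsD[OF assms]) auto
    moreover have "(A \<inter> M) \<union> (B \<inter> M) = (A \<union> B) \<inter> M" "(A \<inter> M) \<inter> (B \<inter> M) = A \<inter> B \<inter> M"
      by auto
    ultimately show ?thesis by simp
  qed
  then show ?thesis
    by (auto simp: modular_funs_def lift_fun_in_set_funs lift_fun_apply le_infI1)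
qed

lemma lift_fun_supermodular_iff:
  assumes "M \<subseteq> N" "r \<in> set_funs M"
  shows "lift_fun M N r \<in> supermodular_funs N \<longleftrightarrow> r \<in> supermodular_funs M"
proof
  assume *: "lift_fun M N r \<in> supermodular_funs N"
  \<comment> \<open>The lift agrees with \<open>r\<close> on subsets of \<open>M\<close>, so every
    inequality for \<open>r\<close> is an instance of one for the lift.\<close>
  have eq: "lift_fun M N r S = r S" if "S \<subseteq> M" for S
    using that assms(1) by (simp add: lift_fun_apply Int_absorb2 subset_trans)
  have "r A + r B \<le> r (A \<union> B) + r (A \<inter> B)" if "A \<subseteq> M" "B \<subseteq> M" for A B
  proof -
    have "lift_fun M N r A + lift_fun M N r B
       \<le> lift_fun M N r (A \<union> B) + lift_fun M N r (A \<inter> B)"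
      using * that assms(1) by (auto simp: supermodular_funs_def)
    then show ?thesis using that by (simp add: eq le_infI1)
  qed
  then show "r \<in> supermodular_funs M"
    using assms(2) by (simp add: supermodular_funs_def)
qed (rule lift_fun_supermodular)

text \<open>Intersecting with \<open>M\<close> erases an element outside \<open>M\<close>, so if
  \<open>a\<close> or \<open>b\<close> is not in \<open>M\<close>, the four terms cancel in pairs.
  If both are in \<open>M\<close>, the expression becomes that of \<open>r\<close> at
  \<open>C \<inter> M\<close>.\<close>

lemma indep_lift_fun:
  assumes "(a, b, C) \<in> triplets N"
  shows "indep (lift_fun M N r) a b C \<longleftrightarrow> a \<notin> M \<or> b \<notin> M \<or> indep r a b (C \<inter> M)"
proof -
  have sub: "insert a (insert b C) \<subseteq> N" "insert a C \<subseteq> N" "insert b C \<subseteq> N" "C \<subseteq> N"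
    using assms by (auto simp: triplets_def)
  show ?thesis
    using sub by (simp add: indep_def lift_fun_apply Int_insert_left)
qed

section \<open>Affine form of modular functions and a criterion for complementarity\<close>

lemma modular_affine:
  assumes "finite N"
  shows "(\<lambda>S\<in>Pow N. c + sum a S) \<in> modular_funs N"
proof (rule modular_funsI)
  fix A B assume "A \<subseteq> N" "B \<subseteq> N"
  moreover from this have "finite A" "finite B" using assms finite_subset by blast+
  ultimately show "(\<lambda>S\<in>Pow N. c + sum a S) A + (\<lambda>S\<in>Pow N. c + sum a S) B
      = (\<lambda>S\<in>Pow N. c + sum a S) (A \<union> B) + (\<lambda>S\<in>Pow N. c + sum a S) (A \<inter> B)"
    using sum.union_inter[of A B a] by (simp add: le_infI1)
qed (simp add: set_funs_def)

text \<open>The slope at \<open>i\<close> is the increment \<open>u {i} - u {}\<close>. Modularity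
  on the disjoint sets \<open>{x}\<close> and \<open>F\<close> adds one such increment per element,
  by induction on the finite set.\<close>

lemma modular_affineE:
  assumes "finite N" "u \<in> modular_funs N"
  obtains a where "\<And>S. S \<subseteq> N \<Longrightarrow> u S = u {} + (\<Sum>i\<in>S. a i)"
proof
  fix S assume "S \<subseteq> N"
  then have "finite S" using assms(1) finite_subset by blast
  then show "u S = u {} + (\<Sum>i\<in>S. u {i} - u {})" using \<open>S \<subseteq> N\<close>
  proof (induction S)
    case (insert x F)
    have "u {x} + u F = u ({x} \<union> F) + u ({x} \<inter> F)"
      by (rule modular_funsD[OF assms(2)]) (use insert.prems in auto)
    then show ?case using insert by simp
  qed simp
qed

text \<open>This is what makes the definite description in \<open>standardization\<close>
  meaningful. Quantifying over every \<open>m\<close> is harmless, since only the values of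
  \<open>m\<close> on \<open>Pow N\<close> enter.\<close>

definition standardizing :: "('a set \<Rightarrow> ('a set \<Rightarrow> real) set) \<Rightarrow> 'a set \<Rightarrow> bool" where
  "standardizing X N \<longleftrightarrow>
     (\<forall>m. \<exists>!s. s \<in> X N \<and> (\<lambda>S\<in>Pow N. m S - s S) \<in> modular_funs N)"

text \<open>\<open>s - t\<close> is \<open>(m - t) - (m - s)\<close>, and modular functions are
  closed under differences.\<close>

lemma modular_diff:
  assumes "(\<lambda>S\<in>Pow N. m S - s S) \<in> modular_funs N" "(\<lambda>S\<in>Pow N. m S - t S) \<in> modular_funs N"
  shows "(\<lambda>S\<in>Pow N. s S - t S) \<in> modular_funs N"
proof (rule modular_funsI)
  fix A B assume "A \<subseteq> N" "B \<subseteq> N"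
  then show "(\<lambda>S\<in>Pow N. s S - t S) A + (\<lambda>S\<in>Pow N. s S - t S) B
      = (\<lambda>S\<in>Pow N. s S - t S) (A \<union> B) + (\<lambda>S\<in>Pow N. s S - t S) (A \<inter> B)"
    using modular_funsD[OF assms(1), of A B] modular_funsD[OF assms(2), of A B]
    by (simp add: le_infI1)
qed (simp add: set_funs_def)

text \<open>Modular functions are exactly the affine ones, so complementarity can be tested on
  \<open>c + sum a S\<close> alone: \<open>ex\<close> gives existence, while \<open>diff\<close>
  reduces uniqueness to a single affine element of \<open>X N\<close>, which \<open>triv\<close>
  shows to be zero.\<close>

lemma standardizingI:
  assumes fin: "finite N" and funs: "X N \<subseteq> set_funs N"
    and diff: "\<And>s t. s \<in> X N \<Longrightarrow> t \<in> X N \<Longrightarrow> (\<lambda>S\<in>Pow N. s S - t S) \<in> X N"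
    and triv: "\<And>u c a. u \<in> X N \<Longrightarrow> (\<And>S. S \<subseteq> N \<Longrightarrow> u S = c + sum a S) \<Longrightarrow>
      c = 0 \<and> (\<forall>i\<in>N. a i = 0)"
    and ex: "\<And>m. \<exists>c a. (\<lambda>S\<in>Pow N. m S - (c + sum a S)) \<in> X N"
  shows "standardizing X N"
  unfolding standardizing_def
proof (intro allI ex_ex1I)
  fix m
  obtain c a where ca: "(\<lambda>S\<in>Pow N. m S - (c + sum a S)) \<in> X N" using ex by blast
  have "(\<lambda>S\<in>Pow N. m S - (\<lambda>S\<in>Pow N. m S - (c + sum a S)) S) = (\<lambda>S\<in>Pow N. c + sum a S)"
    by (auto intro!: restrict_ext)
  with ca modular_affine[OF fin]
  show "\<exists>s. s \<in> X N \<and> (\<lambda>S\<in>Pow N. m S - s S) \<in> modular_funs N" by metis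
next
  fix m s t
  assume s: "s \<in> X N \<and> (\<lambda>S\<in>Pow N. m S - s S) \<in> modular_funs N"
    and t: "t \<in> X N \<and> (\<lambda>S\<in>Pow N. m S - t S) \<in> modular_funs N"
  define u where "u = (\<lambda>S\<in>Pow N. s S - t S)"
  have "u \<in> modular_funs N" unfolding u_def by (rule modular_diff[OF conjunct2[OF s] conjunct2[OF t]])
  then obtain a where a: "\<And>S. S \<subseteq> N \<Longrightarrow> u S = u {} + sum a S"
    using modular_affineE[OF fin] by metis
  have "u \<in> X N" unfolding u_def by (rule diff[OF conjunct1[OF s] conjunct1[OF t]])
  from triv[OF this a] have z: "u {} = 0" "\<forall>i\<in>N. a i = 0" by auto
  have "s S = t S" if "S \<subseteq> N" for S
  proof -
    have "sum a S = 0" using z(2) that by (intro sum.neutral) auto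
    then have "u S = 0" using a[OF that] z(1) by simp
    then show ?thesis using that by (simp add: u_def)
  qed
  \<comment> \<open>Agreement on \<open>Pow N\<close> suffices because both functions are
    \<open>undefined\<close> elsewhere.\<close>
  moreover have "s \<in> Pow N \<rightarrow>\<^sub>E UNIV" "t \<in> Pow N \<rightarrow>\<^sub>E UNIV"
    using s t funs by (auto simp: set_funs_def)
  ultimately show "s = t" by (metis PiE_ext PowD)
qed

lemma standardization_lift_fun:
  assumes "standardizing X M" "standardizing X N"
    and lift: "\<And>s. s \<in> X M \<Longrightarrow> lift_fun M N s \<in> X N"
  shows "standardization X N (lift_fun M N r) = lift_fun M N (standardization X M r)"
proof -
  define s where "s = standardization X M r"
  have "\<exists>!s. s \<in> X M \<and> (\<lambda>S\<in>Pow M. r S - s S) \<in> modular_funs M"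
    using assms(1) by (simp add: standardizing_def)
  from theI'[OF this] have s: "s \<in> X M" "(\<lambda>S\<in>Pow M. r S - s S) \<in> modular_funs M"
    unfolding s_def standardization_def by auto
  \<comment> \<open>Lifting is linear, so the difference of the lifts is the lift of the modular
    function \<open>r - s\<close>.\<close>
  have "(\<lambda>S\<in>Pow N. lift_fun M N r S - lift_fun M N s S)
      = lift_fun M N (\<lambda>S\<in>Pow M. r S - s S)"
    by (auto simp: lift_fun_def intro!: restrict_ext)
  then have "(\<lambda>S\<in>Pow N. lift_fun M N r S - lift_fun M N s S) \<in> modular_funs N"
    using lift_fun_modular[OF s(2)] by simp
  moreover have "\<exists>!s. s \<in> X N \<and> (\<lambda>S\<in>Pow N. lift_fun M N r S - s S) \<in> modular_funs N"
    using assms(2) unfolding standardizing_def by blast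
  ultimately have "standardization X N (lift_fun M N r) = lift_fun M N s"
    unfolding standardization_def using lift[OF s(1)] by blast
  then show ?thesis by (simp add: s_def)
qed

section \<open>Complementarity of the three standardizing subspaces\<close>

lemma standardizing_l:
  assumes "finite N"
  shows "standardizing std_space_l N"
proof (rule standardizingI[OF assms])
  show "c = 0 \<and> (\<forall>i\<in>N. a i = 0)"
    if "u \<in> std_space_l N" "\<And>S. S \<subseteq> N \<Longrightarrow> u S = c + sum a S" for u c a
    using that(1) that(2)[of "{}"] that(2)[of "{_}"] by (auto simp: std_space_l_def)
  show "\<exists>c a. (\<lambda>S\<in>Pow N. m S - (c + sum a S)) \<in> std_space_l N" for m
    \<comment> \<open>The witnesses are forced: the affine function must interpolate
      \<open>m\<close> at \<open>{}\<close> and at every singleton.\<close>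
    by (intro exI[of _ "m {}"] exI[of _ "\<lambda>i. m {i} - m {}"])
       (auto simp: std_space_l_def set_funs_def)
qed (auto simp: std_space_l_def set_funs_def)

lemma standardizing_u:
  assumes "finite N"
  shows "standardizing std_space_u N"
proof (rule standardizingI[OF assms])
  show "c = 0 \<and> (\<forall>i\<in>N. a i = 0)"
    if u: "u \<in> std_space_u N" and eq: "\<And>S. S \<subseteq> N \<Longrightarrow> u S = c + sum a S" for u c a
  proof -
    have N: "c + sum a N = 0" using u eq[of N] by (simp add: std_space_u_def)
    \<comment> \<open>The values of \<open>u\<close> at \<open>N\<close> and at
      \<open>N - {i}\<close> both vanish, and they differ by \<open>a i\<close>.\<close>
    have a: "a i = 0" if "i \<in> N" for i
      using u eq[of "N - {i}"] N that sum.remove[OF assms that, of a]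
      by (auto simp: std_space_u_def)
    then show ?thesis using N by simp
  qed
  show "\<exists>c a. (\<lambda>S\<in>Pow N. m S - (c + sum a S)) \<in> std_space_u N" for m
  proof -
    \<comment> \<open>The slope is forced by the loss on deleting \<open>i\<close> from
      \<open>N\<close>; the constant \<open>m N - sum a N\<close> then makes the affine function
      agree with \<open>m\<close> at \<open>N\<close>.\<close>
    define a where "a i = m N - m (N - {i})" for i
    have "sum a (N - {i}) = sum a N - a i" if "i \<in> N" for i
      using sum.remove[OF assms that, of a] by simp
    then show ?thesis
      by (intro exI[of _ "m N - sum a N"] exI[of _ a])
         (auto simp: std_space_u_def set_funs_def a_def)
  qed
qed (auto simp: std_space_u_def set_funs_def)

text \<open>Deleting \<open>i\<close> is a bijection from the sets containing \<open>i\<close> to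
  those that avoid it.\<close>

lemma sum_Pow_remove:
  fixes m :: "'a set \<Rightarrow> real"
  assumes "finite N" "i \<in> N"
  shows "(\<Sum>S\<in>Pow N. m S) = (\<Sum>S\<in>{S \<in> Pow N. i \<in> S}. m S) + (\<Sum>S\<in>{S \<in> Pow N. i \<in> S}. m (S - {i}))"
proof -
  have "(\<Sum>S\<in>{S \<in> Pow N. i \<in> S}. m (S - {i})) = (\<Sum>S\<in>{S \<in> Pow N. i \<notin> S}. m S)"
    by (rule sum.reindex_bij_witness[of _ "insert i" "\<lambda>S. S - {i}"]) (use assms(2) in auto)
  moreover have "(\<Sum>S\<in>Pow N. m S)
      = (\<Sum>S\<in>{S \<in> Pow N. i \<in> S}. m S) + (\<Sum>S\<in>{S \<in> Pow N. i \<notin> S}. m S)"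
    using sum.Int_Diff[of "Pow N" m "{S. i \<in> S}"] assms(1)
    by (simp add: Int_def set_diff_eq)
  ultimately show ?thesis by simp
qed

text \<open>When the total is zero, the sum over sets avoiding \<open>i\<close> is minus the sum
  over sets containing \<open>i\<close>, so the sum of differences is twice the latter. The
  difference form kills constants and isolates the slope at \<open>i\<close> of an affine
  function.\<close>

lemma std_space_o_iff:
  assumes "finite N"
  shows "m \<in> std_space_o N \<longleftrightarrow> m \<in> set_funs N \<and> (\<Sum>S\<in>Pow N. m S) = 0 \<and>
    (\<forall>i\<in>N. (\<Sum>S\<in>{S \<in> Pow N. i \<in> S}. m S - m (S - {i})) = 0)"
proof -
  have "(\<Sum>S\<in>{S \<in> Pow N. i \<in> S}. m S) = 0
      \<longleftrightarrow> (\<Sum>S\<in>{S \<in> Pow N. i \<in> S}. m S - m (S - {i})) = 0"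
    if "i \<in> N" "(\<Sum>S\<in>Pow N. m S) = 0" for i
    using sum_Pow_remove[OF assms that(1), of m] that(2)
    by (subst sum_subtractf) linarith
  then show ?thesis unfolding std_space_o_def by auto
qed

lemma standardizing_o:
  assumes "finite N"
  shows "standardizing std_space_o N"
proof (rule standardizingI[OF assms])
  \<comment> \<open>On an affine function the sum of differences for \<open>i\<close> equals
    \<open>k i\<close> times the slope at \<open>i\<close>, so the slope is recovered by dividing by
    \<open>k i\<close>.\<close>
  define k where "k i = real (card {S \<in> Pow N. i \<in> S})" for i
  have k: "k i \<noteq> 0" if "i \<in> N" for i
    unfolding k_def using that assms by (auto simp: card_eq_0_iff)
  have rm: "sum a S - sum a (S - {i}) = a i" if "S \<subseteq> N" "i \<in> S" for a :: "'a \<Rightarrow> real" and i S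
    using sum.remove[OF finite_subset[OF that(1) assms] that(2), of a] by simp
  show "std_space_o N \<subseteq> set_funs N" by (auto simp: std_space_o_def)
  show "(\<lambda>S\<in>Pow N. s S - t S) \<in> std_space_o N"
    if "s \<in> std_space_o N" "t \<in> std_space_o N" for s t
    using that by (auto simp: std_space_o_def set_funs_def sum_subtractf)
  show "c = 0 \<and> (\<forall>i\<in>N. a i = 0)"
    if u: "u \<in> std_space_o N" and eq: "\<And>S. S \<subseteq> N \<Longrightarrow> u S = c + sum a S" for u c a
  proof -
    have a: "a i = 0" if i: "i \<in> N" for i
    proof -
      have "(\<Sum>S\<in>{S \<in> Pow N. i \<in> S}. u S - u (S - {i})) = (\<Sum>S\<in>{S \<in> Pow N. i \<in> S}. a i)"
      proof (rule sum.cong)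
        fix S assume S: "S \<in> {S \<in> Pow N. i \<in> S}"
        then have "S \<subseteq> N" "S - {i} \<subseteq> N" by auto
        then show "u S - u (S - {i}) = a i"
          using eq[of S] eq[of "S - {i}"] rm[of S i a] S by simp
      qed simp
      then have "k i * a i = 0"
        using u i by (simp add: std_space_o_iff[OF assms] k_def)
      then show ?thesis using k[OF i] by simp
    qed
    \<comment> \<open>With all slopes zero, \<open>u\<close> is constant on \<open>Pow N\<close>,
      and its vanishing total forces the constant to be zero.\<close>
    then have "u S = c" if "S \<subseteq> N" for S
      using eq[OF that] that by (simp add: subset_iff)
    then have "(\<Sum>S\<in>Pow N. u S) = real (card (Pow N)) * c" by simp
    then have "c = 0" using u assms by (simp add: std_space_o_def card_Pow)
    with a show ?thesis by simp
  qed
  show "\<exists>c a. (\<lambda>S\<in>Pow N. m S - (c + sum a S)) \<in> std_space_o N" for m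
  proof -
    \<comment> \<open>The slope is the average marginal gain of \<open>i\<close> over the sets
      containing it; \<open>c\<close> is the average of what remains after the additive part is
      removed, so that the total becomes zero.\<close>
    define a where "a i = (\<Sum>S\<in>{S \<in> Pow N. i \<in> S}. m S - m (S - {i})) / k i" for i
    define c where "c = (\<Sum>S\<in>Pow N. m S - sum a S) / real (card (Pow N))"
    define s where "s = (\<lambda>S\<in>Pow N. m S - (c + sum a S))"
    have "(\<Sum>S\<in>Pow N. s S) = (\<Sum>S\<in>Pow N. (m S - sum a S) - c)"
      by (simp add: s_def algebra_simps)
    also have "\<dots> = 0"
      using assms by (simp add: sum_subtractf c_def card_Pow)
    finally have tot: "(\<Sum>S\<in>Pow N. s S) = 0" .
    have "(\<Sum>S\<in>{S \<in> Pow N. i \<in> S}. s S - s (S - {i})) = 0" if i: "i \<in> N" for i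
    proof -
      have "(\<Sum>S\<in>{S \<in> Pow N. i \<in> S}. s S - s (S - {i}))
          = (\<Sum>S\<in>{S \<in> Pow N. i \<in> S}. (m S - m (S - {i})) - a i)"
      proof (rule sum.cong)
        fix S assume S: "S \<in> {S \<in> Pow N. i \<in> S}"
        then have "S - {i} \<in> Pow N" by auto
        with S show "s S - s (S - {i}) = (m S - m (S - {i})) - a i"
          using rm[of S i a] by (simp add: s_def)
      qed simp
      also have "\<dots> = (\<Sum>S\<in>{S \<in> Pow N. i \<in> S}. m S - m (S - {i})) - k i * a i"
        by (subst sum_subtractf) (simp add: k_def)
      also have "\<dots> = 0" using k[OF i] by (simp add: a_def)
      finally show ?thesis .
    qed
    with tot have "s \<in> std_space_o N"
      by (simp add: std_space_o_iff[OF assms]) (simp add: s_def set_funs_def)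
    then show ?thesis unfolding s_def by blast
  qed
qed

section \<open>Lifting of the standardizing subspaces\<close>

lemma sum_Pow_Int:
  fixes g :: "'a set \<Rightarrow> real"
  assumes "finite N" "M \<subseteq> N"
  shows "(\<Sum>S\<in>Pow N. g (S \<inter> M)) = real (card (Pow (N - M))) * (\<Sum>T\<in>Pow M. g T)"
proof -
  \<comment> \<open>A set \<open>S\<close> corresponds to the pair of its traces on \<open>M\<close>
    and on \<open>N - M\<close>; the summand ignores the second, which yields the factor.\<close>
  have "(\<Sum>S\<in>Pow N. g (S \<inter> M)) = (\<Sum>(T, U)\<in>Pow M \<times> Pow (N - M). g T)"
    by (rule sum.reindex_bij_witness[of _ "\<lambda>(T, U). T \<union> U" "\<lambda>S. (S \<inter> M, S - M)"])
       (use assms(2) in auto)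
  also have "\<dots> = (\<Sum>T\<in>Pow M. \<Sum>U\<in>Pow (N - M). g T)"
    by (rule sum.cartesian_product[symmetric])
  finally show ?thesis by (simp add: sum_distrib_left)
qed

lemma lift_fun_std_space_l:
  assumes "s \<in> std_space_l M"
  shows "lift_fun M N s \<in> std_space_l N"
proof -
  \<comment> \<open>For \<open>i\<close> outside \<open>M\<close> the intersection is empty, and
    \<open>s\<close> vanishes there too.\<close>
  have "s ({i} \<inter> M) = 0" for i
    using assms by (cases "i \<in> M") (auto simp: std_space_l_def)
  moreover have "s {} = 0" using assms by (simp add: std_space_l_def)
  ultimately show ?thesis
    by (simp add: std_space_l_def lift_fun_apply lift_fun_in_set_funs)
qed

lemma lift_fun_std_space_u:
  assumes "M \<subseteq> N" "s \<in> std_space_u M"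
  shows "lift_fun M N s \<in> std_space_u N"
proof -
  have "(N - {i}) \<inter> M = M - {i}" "N \<inter> M = M" for i using assms(1) by auto
  \<comment> \<open>For \<open>i\<close> outside \<open>M\<close> this set is \<open>M\<close>
    itself, where \<open>s\<close> vanishes as well.\<close>
  moreover have "s (M - {i}) = 0" for i
    using assms(2) by (cases "i \<in> M") (auto simp: std_space_u_def)
  moreover have "s M = 0" using assms(2) by (simp add: std_space_u_def)
  ultimately show ?thesis
    using lift_fun_in_set_funs[of M N s] by (simp add: std_space_u_def lift_fun_apply Diff_subset)
qed

text \<open>In the difference form of the conditions, each sum for the lift is a multiple of the
  corresponding sum for \<open>s\<close>, except that for \<open>i\<close> outside \<open>M\<close>
  every single difference is already zero.\<close>

lemma lift_fun_std_space_o: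
  assumes "finite N" "M \<subseteq> N" and s: "s \<in> std_space_o M"
  shows "lift_fun M N s \<in> std_space_o N"
proof -
  have "(\<Sum>S\<in>Pow N. lift_fun M N s S) = (\<Sum>S\<in>Pow N. s (S \<inter> M))"
    by (simp add: lift_fun_apply)
  then have tot: "(\<Sum>S\<in>Pow N. lift_fun M N s S) = 0"
    using s by (simp add: sum_Pow_Int[OF assms(1,2)] std_space_o_def)
  have finM: "finite M" using assms(1,2) finite_subset by blast
  have "(\<Sum>S\<in>{S \<in> Pow N. i \<in> S}. lift_fun M N s S - lift_fun M N s (S - {i})) = 0" if "i \<in> N" for i
  proof (cases "i \<in> M")
    case False
    then have "lift_fun M N s S - lift_fun M N s (S - {i}) = 0" if "S \<subseteq> N" for S
    proof -
      have "(S - {i}) \<inter> M = S \<inter> M" using False by auto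
      then show ?thesis using that by (simp add: lift_fun_apply subset_trans[OF Diff_subset])
    qed
    then show ?thesis by (intro sum.neutral) blast
  next
    case True
    \<comment> \<open>Extension by zero to sets avoiding \<open>i\<close> turns the restricted sums
      into sums over full power sets, to which \<open>sum_Pow_Int\<close> applies.\<close>
    define g where "g T = (if i \<in> T then s T - s (T - {i}) else 0)" for T
    have "(\<Sum>S\<in>{S \<in> Pow N. i \<in> S}. lift_fun M N s S - lift_fun M N s (S - {i}))
        = (\<Sum>S\<in>{S \<in> Pow N. i \<in> S}. g (S \<inter> M))"
    proof (rule sum.cong)
      fix S assume S: "S \<in> {S \<in> Pow N. i \<in> S}"
      have "(S - {i}) \<inter> M = S \<inter> M - {i}" by auto
      moreover have "S - {i} \<subseteq> N" using S by auto
      ultimately show "lift_fun M N s S - lift_fun M N s (S - {i}) = g (S \<inter> M)"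
        using S True by (simp add: lift_fun_apply g_def)
    qed simp
    also have "\<dots> = (\<Sum>S\<in>Pow N. g (S \<inter> M))"
      by (rule sum.mono_neutral_left) (use assms(1) in \<open>auto simp: g_def\<close>)
    also have "\<dots> = real (card (Pow (N - M))) * (\<Sum>T\<in>Pow M. g T)"
      by (rule sum_Pow_Int[OF assms(1,2)])
    also have "(\<Sum>T\<in>Pow M. g T) = (\<Sum>T\<in>{T \<in> Pow M. i \<in> T}. s T - s (T - {i}))"
      by (rule sum.mono_neutral_cong_right) (use finM in \<open>auto simp: g_def\<close>)
    also have "\<dots> = 0" using s True by (simp add: std_space_o_iff[OF finM])
    finally show ?thesis by simp
  qed
  with tot show ?thesis
    by (simp add: std_space_o_iff[OF assms(1)] lift_fun_in_set_funs)
qed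

theorem mainTheorem3:
  fixes N M :: "'a set" and r :: "'a set \<Rightarrow> real"
  assumes "finite N" and "card N \<ge> 2" and "M \<subseteq> N" and "r \<in> set_funs M"
  shows "(r \<in> supermodular_funs M \<longleftrightarrow> lift_fun M N r \<in> supermodular_funs N)
    \<and> (\<forall>a b C. (a, b, C) \<in> triplets N \<longrightarrow>
          (indep (lift_fun M N r) a b C \<longleftrightarrow> a \<notin> M \<or> b \<notin> M \<or> indep r a b (C \<inter> M)))
    \<and> indep_model N (lift_fun M N r) =
        {(a, b, C). (a, b, C) \<in> triplets N \<and> (a \<notin> M \<or> b \<notin> M \<or> indep r a b (C \<inter> M))}
    \<and> lift_fun M N ` supermodular_funs M \<subseteq> supermodular_funs N
    \<and> (r \<in> supermodular_funs M \<longrightarrow>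
          std_l N (lift_fun M N r) = lift_fun M N (std_l M r)
        \<and> std_u N (lift_fun M N r) = lift_fun M N (std_u M r)
        \<and> std_o N (lift_fun M N r) = lift_fun M N (std_o M r))"
proof -
  have finM: "finite M" using assms(1,3) finite_subset by blast
  have "indep_model N (lift_fun M N r) =
      {(a, b, C). (a, b, C) \<in> triplets N \<and> (a \<notin> M \<or> b \<notin> M \<or> indep r a b (C \<inter> M))}"
    unfolding indep_model_def using indep_lift_fun[of _ _ _ N M r] by blast
  \<comment> \<open>Complementarity is used over both \<open>N\<close> and \<open>M\<close>, where
    \<open>M\<close> may be empty or a singleton.\<close>
  moreover have "std_l N (lift_fun M N r) = lift_fun M N (std_l M r)"
    using standardizing_l[OF finM] standardizing_l[OF assms(1)]
    by (rule standardization_lift_fun) (rule lift_fun_std_space_l)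
  moreover have "std_u N (lift_fun M N r) = lift_fun M N (std_u M r)"
    using standardizing_u[OF finM] standardizing_u[OF assms(1)]
    by (rule standardization_lift_fun) (rule lift_fun_std_space_u[OF assms(3)])
  moreover have "std_o N (lift_fun M N r) = lift_fun M N (std_o M r)"
    using standardizing_o[OF finM] standardizing_o[OF assms(1)]
    by (rule standardization_lift_fun) (rule lift_fun_std_space_o[OF assms(1,3)])
  moreover have "lift_fun M N ` supermodular_funs M \<subseteq> supermodular_funs N"
    by (auto intro: lift_fun_supermodular)
  moreover have "\<forall>a b C. (a, b, C) \<in> triplets N \<longrightarrow>
      (indep (lift_fun M N r) a b C \<longleftrightarrow> a \<notin> M \<or> b \<notin> M \<or> indep r a b (C \<inter> M))"
    by (intro allI impI indep_lift_fun)
  ultimately show ?thesis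
    by (simp only: lift_fun_supermodular_iff[OF assms(3,4)] simp_thms)
qed

end
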